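(* The Weighted Shortest Elapsed Time First rule $\mathrm{WSETF}$ is $2$-competitive for online single-machine preemptive scheduling with release dates minimizing $\sum_j w_jC_j$: for every instance $I$, $\sum_j w_jC_j^{\mathrm{WSETF}}(I)\leq 2\,\mathrm{OPT}(I)$, where $\mathrm{OPT}(I)$ is the optimal objective value of a (clairvoyant, offline) preemptive schedule.
   Context: An instance $I=(\vec p,\vec w,\vec r)$ consists of $n$ jobs with processing times $p_j>0$, weights $w_j>0$ and release dates $r_j\geq 0$; each job becomes known only at its release date, and its processing time is unknown until it completes (non-clairvoyant). A (fractional preemptive) schedule $S$ assigns to each job $j$ a measurable rate $y_j^S(t)\in[0,1]$ with $\sum_j y_j^S(t)\leq1$ for all $t\geq0$ and $y_j^S(t)=0$ if $t<r_j$ or $t>C_j^S$, where $C_j^S$ is the smallest $t$ with $Y_j^S(t):=\int_0^t y_j^S(s)\,ds\geq p_j$ (the elapsed time of $j$). At each time $t$, let $J(t)$ be the set of released unfinished jobs and $A(t)\subseteq J(t)$ the jobs of minimum ratio $Y_j(t)/w_j$; $\mathrm{WSETF}$ sets $y_j(t)=w_j/\sum_{k\in A(t)}w_k$ for $j\in A(t)$ and $y_j(t)=0$ otherwise (equivalently, it distributes the processor so as to maximize $\min_{j\in J(t)}Y_j(t)/w_j$). *)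

theory Defs
  imports "HOL-Analysis.Analysis"
begin

text \<open>The jobs of an instance \<open>I\<close> are the numbers \<open>j < njobs I\<close>.\<close>

record sched_instance =
  njobs :: nat
  ptime :: "nat \<Rightarrow> real"
  weight :: "nat \<Rightarrow> real"
  release :: "nat \<Rightarrow> real"

definition valid_instance :: "sched_instance \<Rightarrow> bool" where
  "valid_instance I \<longleftrightarrow>
    (\<forall>j<njobs I. ptime I j > 0 \<and> weight I j > 0 \<and> release I j \<ge> 0)"

text \<open>Rates \<open>y j t\<close> are only meaningful for \<open>j < njobs I\<close> and \<open>t \<ge> 0\<close>; other values are ignored.\<close>

type_synonym rates = "nat \<Rightarrow> real \<Rightarrow> real"

definition measurable_rates :: "sched_instance \<Rightarrow> rates \<Rightarrow> bool" where
  "measurable_rates I y \<longleftrightarrow> (\<forall>j<njobs I. y j \<in> borel_measurable (lebesgue_on {0..}))"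

definition elapsed :: "rates \<Rightarrow> nat \<Rightarrow> real \<Rightarrow> real" where
  "elapsed y j t = integral {0..t} (y j)"

text \<open>Only meaningful if job \<open>j\<close> completes at all, which \<open>schedule\<close> below requires; the least
  element then exists because \<open>elapsed\<close> is continuous in \<open>t\<close>.\<close>

definition completion :: "sched_instance \<Rightarrow> rates \<Rightarrow> nat \<Rightarrow> real" where
  "completion I y j = (LEAST t. 0 \<le> t \<and> elapsed y j t \<ge> ptime I j)"

definition schedule :: "sched_instance \<Rightarrow> rates \<Rightarrow> bool" where
  "schedule I y \<longleftrightarrow>
    measurable_rates I y \<and>
    (\<forall>j<njobs I. \<forall>t\<ge>0. 0 \<le> y j t \<and> y j t \<le> 1) \<and>
    (\<forall>t\<ge>0. (\<Sum>j<njobs I. y j t) \<le> 1) \<and>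
    (\<forall>j<njobs I. \<exists>t\<ge>0. elapsed y j t \<ge> ptime I j) \<and>
    (\<forall>j<njobs I. \<forall>t\<ge>0. t < release I j \<or> t > completion I y j \<longrightarrow> y j t = 0)"

definition cost :: "sched_instance \<Rightarrow> rates \<Rightarrow> real" where
  "cost I y = (\<Sum>j<njobs I. weight I j * completion I y j)"

definition OPT :: "sched_instance \<Rightarrow> real" where
  "OPT I = Inf {cost I y |y. schedule I y}"

definition active_jobs :: "sched_instance \<Rightarrow> rates \<Rightarrow> real \<Rightarrow> nat set" where
  "active_jobs I y t = {j. j < njobs I \<and> release I j \<le> t \<and> elapsed y j t < ptime I j}"

text \<open>The next two functions describe the decision at a single point in time, given the weights
  \<open>w\<close>, the set \<open>J\<close> of released unfinished jobs and their elapsed times \<open>Y\<close>. That they have no other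
  arguments expresses that the rule is online and non-clairvoyant.\<close>

definition min_ratio_jobs :: "(nat \<Rightarrow> real) \<Rightarrow> nat set \<Rightarrow> (nat \<Rightarrow> real) \<Rightarrow> nat set" where
  "min_ratio_jobs w J Y = {j \<in> J. \<forall>k\<in>J. Y j / w j \<le> Y k / w k}"

definition WSETF_rate :: "(nat \<Rightarrow> real) \<Rightarrow> nat set \<Rightarrow> (nat \<Rightarrow> real) \<Rightarrow> nat \<Rightarrow> real" where
  "WSETF_rate w J Y j =
    (if j \<in> min_ratio_jobs w J Y then w j / (\<Sum>k\<in>min_ratio_jobs w J Y. w k) else 0)"

text \<open>\<open>y\<close> results from running WSETF on \<open>I\<close>. The condition is self-referential, since the active
  jobs and the elapsed times at time \<open>t\<close> are those of \<open>y\<close> itself. That \<open>y\<close> is a \<open>schedule\<close>, in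
  particular that all jobs complete, is deliberately not part of this definition.\<close>

definition WSETF :: "sched_instance \<Rightarrow> rates \<Rightarrow> bool" where
  "WSETF I y \<longleftrightarrow>
    measurable_rates I y \<and>
    (\<forall>t\<ge>0. \<forall>j<njobs I.
      y j t = WSETF_rate (weight I) (active_jobs I y t) (\<lambda>k. elapsed y k t) j)"

end

theory Submission
  imports Defs
begin

text \<open>Write \<open>Y\<close> and \<open>X\<close> for the elapsed times under WSETF and under an arbitrary schedule, and \<open>C\<close> for
  the completion times under the latter. Between \<open>r\<^sub>j\<close> and its completion, job \<open>j\<close> is delayed under
  WSETF by job \<open>k\<close> only while \<open>Y\<^sub>k / w\<^sub>k \<le> p\<^sub>j / w\<^sub>j\<close>. Hence, with \<open>M\<^sub>j\<^sub>k = min (w\<^sub>j p\<^sub>k) (w\<^sub>k p\<^sub>j)\<close>, the cost is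
  at most \<open>\<Sum>\<^sub>j w\<^sub>j r\<^sub>j + \<Sum>\<^sub>j\<^sub>k (M\<^sub>j\<^sub>k - min (w\<^sub>j Y\<^sub>k(r\<^sub>j)) (w\<^sub>k p\<^sub>j))\<close>. In the other schedule, the delays
  \<open>w\<^sub>j (X\<^sub>k(C\<^sub>j) - X\<^sub>k(r\<^sub>j))\<close> that two jobs cause each other add up to at least \<open>M\<^sub>j\<^sub>k\<close> minus the
  corresponding terms \<open>min (w\<^sub>j X\<^sub>k(r\<^sub>j)) (w\<^sub>k p\<^sub>j)\<close> and \<open>min (w\<^sub>k X\<^sub>j(r\<^sub>k)) (w\<^sub>j p\<^sub>k)\<close>, so twice its cost is at
  least \<open>\<Sum>\<^sub>j 2 w\<^sub>j r\<^sub>j + \<Sum>\<^sub>j\<^sub>k (M\<^sub>j\<^sub>k - 2 min (w\<^sub>j X\<^sub>k(r\<^sub>j)) (w\<^sub>k p\<^sub>j))\<close>. The two bounds match because WSETF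
  maximizes \<open>\<Sum>\<^sub>k min (Y\<^sub>k(t)) (\<theta> w\<^sub>k)\<close> over all schedules, for every \<open>t\<close> and \<open>\<theta>\<close>, and because
  \<open>\<Sum>\<^sub>k X\<^sub>k(r\<^sub>j) \<le> r\<^sub>j\<close>. A run of WSETF exists since its rates only change at finitely many events.\<close>

section \<open>Rates and completion times\<close>

text \<open>The part of \<open>schedule\<close> that can be checked for a WSETF run before its jobs
  are known to complete, so that the facts on elapsed times are available for proving
  completion.\<close>

definition admissible :: "sched_instance \<Rightarrow> rates \<Rightarrow> bool" where
  "admissible I y \<longleftrightarrow> measurable_rates I y \<and>
    (\<forall>j<njobs I. \<forall>t\<ge>0. 0 \<le> y j t \<and> y j t \<le> 1) \<and>
    (\<forall>t\<ge>0. (\<Sum>j<njobs I. y j t) \<le> 1)"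

lemma bounded_measurable_integrable_on:
  fixes f :: "real \<Rightarrow> real"
  assumes "f \<in> borel_measurable (lebesgue_on {0..})"
    and "\<And>t. 0 \<le> t \<Longrightarrow> \<bar>f t\<bar> \<le> B" and "0 \<le> a"
  shows "f integrable_on {a..b}"
proof (rule measurable_bounded_by_integrable_imp_integrable_real[where g="\<lambda>_. B"])
  show "f \<in> borel_measurable (lebesgue_on {a..b})"
    by (rule measurable_restrict_mono[OF assms(1)]) (use assms(3) in auto)
qed (use assms in \<open>auto simp: integrable_const_ivl\<close>)

lemma closed_preimage_atLeastAtMost:
  fixes f :: "real \<Rightarrow> real"
  assumes "continuous_on {a..b} f" "closed B"
  shows "closed {u \<in> {a..b}. f u \<in> B}"
  using continuous_closed_preimage[OF assms(1) closed_atLeastAtMost assms(2)]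
  by (simp add: vimage_def Int_def)

lemma schedule_admissible: "schedule I y \<Longrightarrow> admissible I y"
  by (simp add: schedule_def admissible_def)

lemma elapsed_0 [simp]: "elapsed y j 0 = 0"
  by (simp add: elapsed_def)

section \<open>Elapsed and completion times of admissible rates\<close>

context
  fixes I y
  assumes adm: "admissible I y"
begin

lemma rate_nonneg: "j < njobs I \<Longrightarrow> 0 \<le> t \<Longrightarrow> 0 \<le> y j t"
  and rate_le_1: "j < njobs I \<Longrightarrow> 0 \<le> t \<Longrightarrow> y j t \<le> 1"
  and sum_rates_le_1: "0 \<le> t \<Longrightarrow> (\<Sum>j<njobs I. y j t) \<le> 1"
  using adm by (auto simp: admissible_def)

lemma rate_integrable: "y j integrable_on {a..b}" if "j < njobs I" "0 \<le> a"
  using adm that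
  by (intro bounded_measurable_integrable_on[where B=1])
     (auto simp: admissible_def measurable_rates_def)

lemma elapsed_diff:
  assumes "j < njobs I" "0 \<le> s" "s \<le> t"
  shows "elapsed y j t - elapsed y j s = integral {s..t} (y j)"
  using Henstock_Kurzweil_Integration.integral_combine[OF assms(2,3) rate_integrable[OF assms(1), of 0 t]]
  by (simp add: elapsed_def)

lemma elapsed_mono: "elapsed y j s \<le> elapsed y j t" if "j < njobs I" "0 \<le> s" "s \<le> t"
proof -
  have "0 \<le> integral {s..t} (y j)"
    using that by (intro integral_nonneg rate_integrable) (auto intro: rate_nonneg)
  then show ?thesis using elapsed_diff[OF that] by simp
qed

lemma elapsed_nonneg: "0 \<le> elapsed y j t" if "j < njobs I" "0 \<le> t"
  using elapsed_mono[of j 0 t] that by simp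

lemma elapsed_continuous_on: "continuous_on {a..b} (elapsed y j)" if "j < njobs I" "0 \<le> a"
proof -
  have "continuous_on {0..b} (\<lambda>t. integral {0..t} (y j))"
    by (rule indefinite_integral_continuous_1) (rule rate_integrable[OF that(1)], simp)
  then show ?thesis
    unfolding elapsed_def by (rule continuous_on_subset) (use that in auto)
qed

lemma sum_elapsed_diff:
  assumes "0 \<le> s" "s \<le> t"
  shows "(\<Sum>j<njobs I. elapsed y j t - elapsed y j s) = integral {s..t} (\<lambda>u. \<Sum>j<njobs I. y j u)"
proof -
  have "integral {s..t} (\<lambda>u. \<Sum>j<njobs I. y j u) = (\<Sum>j<njobs I. integral {s..t} (y j))"
    by (rule integral_sum) (use assms in \<open>auto intro: rate_integrable\<close>)
  then show ?thesis using assms by (simp add: elapsed_diff)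
qed

lemma sum_rates_integrable:
  "0 \<le> s \<Longrightarrow> (\<lambda>u. \<Sum>j<njobs I. y j u) integrable_on {s..t}"
  by (intro integrable_sum rate_integrable) auto

lemma sum_elapsed_diff_le:
  assumes "0 \<le> s" "s \<le> t"
  shows "(\<Sum>j<njobs I. elapsed y j t - elapsed y j s) \<le> t - s"
proof -
  have "integral {s..t} (\<lambda>u. \<Sum>j<njobs I. y j u) \<le> integral {s..t} (\<lambda>_. 1)"
    using assms by (intro integral_le sum_rates_integrable) (auto intro: sum_rates_le_1)
  then show ?thesis using assms by (simp add: sum_elapsed_diff)
qed

lemma sum_elapsed_diff_eq:
  assumes "0 \<le> s" "s \<le> t" "\<And>u. s < u \<Longrightarrow> u < t \<Longrightarrow> (\<Sum>j<njobs I. y j u) = 1"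
  shows "(\<Sum>j<njobs I. elapsed y j t - elapsed y j s) = t - s"
proof -
  have "integral {s..t} (\<lambda>u. \<Sum>j<njobs I. y j u) = integral {s..t} (\<lambda>_. 1)"
    by (rule integral_spike[where S="{s,t}"]) (use assms in auto)
  then show ?thesis using assms by (simp add: sum_elapsed_diff)
qed

lemma elapsed_constant:
  assumes "j < njobs I" "0 \<le> s" "s \<le> t" "\<And>u. s < u \<Longrightarrow> u < t \<Longrightarrow> y j u = 0"
  shows "elapsed y j t = elapsed y j s"
proof -
  have "integral {s..t} (y j) = integral {s..t} (\<lambda>_. 0)"
    by (rule integral_spike[where S="{s,t}"]) (use assms in auto)
  then show ?thesis using assms elapsed_diff[of j s t] by simp
qed

text \<open>Consider the last time in \<open>{s..t}\<close> at which the bound holds. Afterwards the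
  elapsed time exceeds \<open>c\<close>, so the rate vanishes and the elapsed time no longer
  changes.\<close>

lemma elapsed_le_max:
  assumes j: "j < njobs I" and st: "0 \<le> s" "s \<le> t"
    and stop: "\<And>u. s < u \<Longrightarrow> u < t \<Longrightarrow> c < elapsed y j u \<Longrightarrow> y j u = 0"
  shows "elapsed y j t \<le> max (elapsed y j s) c"
proof -
  let ?m = "max (elapsed y j s) c"
  let ?S = "{u \<in> {s..t}. elapsed y j u \<in> {..?m}}"
  have "closed ?S"
    by (intro closed_preimage_atLeastAtMost elapsed_continuous_on j st) simp
  moreover have "s \<in> ?S" and bdd: "bdd_above ?S" using st by (auto intro: bdd_aboveI[of _ t])
  ultimately have S: "Sup ?S \<in> ?S" by (intro closed_contains_Sup) auto
  have "elapsed y j t = elapsed y j (Sup ?S)"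
  proof (rule elapsed_constant[OF j])
    fix u assume u: "Sup ?S < u" "u < t"
    then have "u \<notin> ?S" using cSup_upper[OF _ bdd] by force
    then show "y j u = 0" using u S by (intro stop) auto
  qed (use S st in auto)
  then show ?thesis using S by simp
qed

text \<open>The witness \<open>T\<close> makes the \<open>LEAST\<close> in \<open>completion\<close>
  meaningful: the times in \<open>{0..T}\<close> with elapsed time exactly \<open>ptime I j\<close>
  form a closed set, nonempty by the intermediate value theorem, so its infimum is attained.\<close>

lemma completion_properties:
  assumes j: "j < njobs I" and p: "0 < ptime I j" and T: "0 \<le> T" "ptime I j \<le> elapsed y j T"
  shows "0 \<le> completion I y j" "elapsed y j (completion I y j) = ptime I j"
    "\<And>t. 0 \<le> t \<Longrightarrow> ptime I j \<le> elapsed y j t \<longleftrightarrow> completion I y j \<le> t"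
proof -
  have ivt: "\<exists>x\<ge>0. x \<le> t \<and> elapsed y j x = ptime I j"
    if "0 \<le> t" "ptime I j \<le> elapsed y j t" for t
    using IVT'[of "elapsed y j" 0 "ptime I j" t] that p elapsed_continuous_on[OF j] by auto
  let ?K = "{t \<in> {0..T}. elapsed y j t \<in> {ptime I j}}"
  have "closed ?K"
    by (intro closed_preimage_atLeastAtMost elapsed_continuous_on j order_refl) simp
  moreover have "?K \<noteq> {}" and bdd: "bdd_below ?K" using ivt[OF T] by (auto intro: bdd_belowI[of _ 0])
  ultimately have K: "Inf ?K \<in> ?K" by (intro closed_contains_Inf) auto
  have least: "Inf ?K \<le> t" if t: "0 \<le> t" "ptime I j \<le> elapsed y j t" for t
  proof (cases "t \<le> T")
    case True
    then obtain x where "x \<in> ?K" "x \<le> t" using ivt[OF t] by auto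
    then show ?thesis using cInf_lower[OF _ bdd] by force
  qed (use K in auto)
  have C: "completion I y j = Inf ?K"
    unfolding completion_def by (rule Least_equality) (use K least in auto)
  show "0 \<le> completion I y j" "elapsed y j (completion I y j) = ptime I j"
    using K unfolding C by auto
  show "ptime I j \<le> elapsed y j t \<longleftrightarrow> completion I y j \<le> t" if "0 \<le> t" for t
    using K least[OF that] elapsed_mono[OF j, of "Inf ?K" t] unfolding C by auto
qed

end

lemma schedule_properties:
  assumes "valid_instance I" "schedule I x" and j: "j < njobs I"
  shows "release I j \<le> completion I x j"
    "\<And>t. 0 \<le> t \<Longrightarrow> elapsed x j t \<le> ptime I j"
    "\<And>t. 0 \<le> t \<Longrightarrow> t \<le> release I j \<Longrightarrow> elapsed x j t = 0"
    "\<And>t. completion I x j \<le> t \<Longrightarrow> elapsed x j t = ptime I j"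
proof -
  note adm = schedule_admissible[OF assms(2)]
  have p: "0 < ptime I j" using assms by (auto simp: valid_instance_def)
  obtain T where T: "0 \<le> T" "ptime I j \<le> elapsed x j T"
    using assms by (auto simp: schedule_def)
  have zero: "x j t = 0" if "0 \<le> t" "t < release I j \<or> completion I x j < t" for t
    using assms that by (auto simp: schedule_def)
  note C = completion_properties[OF adm j p T]
  show rel: "elapsed x j t = 0" if "0 \<le> t" "t \<le> release I j" for t
    using elapsed_constant[OF adm j order_refl that(1)] zero that by auto
  show "release I j \<le> completion I x j"
    using rel[OF C(1)] C(2) p by linarith
  show late: "elapsed x j t = ptime I j" if "completion I x j \<le> t" for t
    using elapsed_constant[OF adm j C(1) that] zero C(1,2) that by auto
  show "elapsed x j t \<le> ptime I j" if "0 \<le> t" for t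
    using late[of t] C(3)[OF that] by linarith
qed

section \<open>Runs of WSETF\<close>

lemma WSETF_rate_nonneg:
  assumes "\<And>k. k \<in> J \<Longrightarrow> 0 < w k"
  shows "0 \<le> WSETF_rate w J Y j"
proof -
  have "0 \<le> (\<Sum>k\<in>min_ratio_jobs w J Y. w k)"
    by (rule sum_nonneg) (use assms in \<open>auto simp: min_ratio_jobs_def intro: less_imp_le\<close>)
  then show ?thesis using assms[of j] by (auto simp: WSETF_rate_def min_ratio_jobs_def)
qed

lemma min_ratio_jobs_nonempty:
  assumes "finite J" "J \<noteq> {}"
  shows "min_ratio_jobs w J Y \<noteq> {}"
  using arg_min_if_finite[OF assms, of "\<lambda>j. Y j / w j"]
  by (force simp: min_ratio_jobs_def not_less)

lemma sum_WSETF_rate: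
  assumes "J \<subseteq> {..<n}" "J \<noteq> {}" "\<And>k. k \<in> J \<Longrightarrow> 0 < w k"
  shows "(\<Sum>j<n. WSETF_rate w J Y j) = 1"
proof -
  let ?A = "min_ratio_jobs w J Y"
  have sub: "?A \<subseteq> {..<n}" "?A \<subseteq> J" using assms(1) by (auto simp: min_ratio_jobs_def)
  have fin: "finite J" "finite ?A"
    using assms(1) sub by (auto intro: finite_subset)
  have "(\<Sum>k\<in>?A. w k) > 0"
    using fin sub assms min_ratio_jobs_nonempty[OF fin(1) assms(2)] by (intro sum_pos) auto
  moreover have "(\<Sum>j<n. WSETF_rate w J Y j) = (\<Sum>j\<in>?A. w j / (\<Sum>k\<in>?A. w k))"
    using sub unfolding WSETF_rate_def by (subst sum.inter_restrict[symmetric]) (auto simp: Int_absorb1)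
  ultimately show ?thesis by (simp flip: sum_divide_distrib)
qed

lemma WSETF_rate_empty [simp]: "WSETF_rate w {} Y j = 0"
  by (simp add: WSETF_rate_def min_ratio_jobs_def)

lemma WSETF_rate_le_1:
  assumes "J \<subseteq> {..<n}" "\<And>k. k \<in> J \<Longrightarrow> 0 < w k" "j < n"
  shows "WSETF_rate w J Y j \<le> 1"
proof (cases "J = {}")
  case False
  have "WSETF_rate w J Y j \<le> (\<Sum>j<n. WSETF_rate w J Y j)"
    using assms by (intro member_le_sum WSETF_rate_nonneg) auto
  then show ?thesis using sum_WSETF_rate[OF assms(1) False assms(2)] by simp
qed simp

lemma active_jobs_subset: "active_jobs I y t \<subseteq> {..<njobs I}"
  by (auto simp: active_jobs_def)

section \<open>Feasibility of WSETF and its work below a ratio level\<close>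

context
  fixes I y
  assumes valid: "valid_instance I" and W: "WSETF I y"
begin

lemma weight_pos: "j < njobs I \<Longrightarrow> 0 < weight I j"
  and ptime_pos: "j < njobs I \<Longrightarrow> 0 < ptime I j"
  and release_nonneg: "j < njobs I \<Longrightarrow> 0 \<le> release I j"
  using valid by (auto simp: valid_instance_def)

lemma active_weight_pos: "k \<in> active_jobs I x t \<Longrightarrow> 0 < weight I k"
  by (auto simp: active_jobs_def weight_pos)

lemma WSETF_eq: "0 \<le> t \<Longrightarrow> j < njobs I \<Longrightarrow>
    y j t = WSETF_rate (weight I) (active_jobs I y t) (\<lambda>k. elapsed y k t) j"
  using W by (simp add: WSETF_def)

lemma WSETF_sum_rates:
  assumes "0 \<le> t"
  shows "(\<Sum>j<njobs I. y j t) = (if active_jobs I y t = {} then 0 else 1)"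
  using assms sum_WSETF_rate[OF active_jobs_subset _ active_weight_pos]
  by (simp add: WSETF_eq)

lemma WSETF_admissible: "admissible I y"
  using W WSETF_sum_rates unfolding admissible_def
  by (auto simp: WSETF_def
      intro!: WSETF_rate_nonneg WSETF_rate_le_1[OF active_jobs_subset] active_weight_pos)

lemma WSETF_rate_nonzero:
  assumes "0 \<le> t" "j < njobs I" "y j t \<noteq> 0"
  shows "j \<in> active_jobs I y t"
    "\<And>k. k \<in> active_jobs I y t \<Longrightarrow> elapsed y j t / weight I j \<le> elapsed y k t / weight I k"
  using assms by (auto simp: WSETF_eq WSETF_rate_def min_ratio_jobs_def split: if_splits)

lemma WSETF_elapsed_le: "elapsed y j t \<le> ptime I j" if "j < njobs I" "0 \<le> t"
proof -
  have "elapsed y j t \<le> max (elapsed y j 0) (ptime I j)"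
  proof (rule elapsed_le_max[OF WSETF_admissible that(1) order_refl that(2)])
    fix u assume "0 < u" "ptime I j < elapsed y j u"
    then show "y j u = 0"
      using WSETF_rate_nonzero(1)[OF _ that(1), of u] by (auto simp: active_jobs_def)
  qed
  then show ?thesis using ptime_pos[OF that(1)] by simp
qed

lemma WSETF_busy:
  assumes "0 \<le> s" "s \<le> t" "\<And>u. s < u \<Longrightarrow> u < t \<Longrightarrow> active_jobs I y u \<noteq> {}"
  shows "(\<Sum>j<njobs I. elapsed y j t - elapsed y j s) = t - s"
  by (rule sum_elapsed_diff_eq[OF WSETF_admissible]) (use assms in \<open>auto simp: WSETF_sum_rates\<close>)

text \<open>A job that never finished would keep the processor busy forever after its release. A
  window of length \<open>?P + 1\<close> then contains more work than the total
  \<open>?P\<close>.\<close>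

lemma WSETF_completes: "\<exists>t\<ge>0. ptime I j \<le> elapsed y j t" if j: "j < njobs I"
proof (rule ccontr)
  assume "\<not> ?thesis"
  then have unfinished: "elapsed y j t < ptime I j" if "0 \<le> t" for t using that by force
  let ?P = "\<Sum>k<njobs I. ptime I k" and ?r = "release I j"
  have "?P \<ge> 0" by (intro sum_nonneg) (auto intro: less_imp_le ptime_pos)
  note r = release_nonneg[OF j]
  have "(\<Sum>k<njobs I. elapsed y k (?r + ?P + 1) - elapsed y k ?r) = ?P + 1"
    using WSETF_busy[of ?r "?r + ?P + 1"] unfinished j r \<open>?P \<ge> 0\<close>
    by (force simp: active_jobs_def)
  moreover have "(\<Sum>k<njobs I. elapsed y k (?r + ?P + 1) - elapsed y k ?r) \<le> ?P"
  proof (intro sum_mono)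
    fix k assume "k \<in> {..<njobs I}"
    then show "elapsed y k (?r + ?P + 1) - elapsed y k ?r \<le> ptime I k"
      using WSETF_elapsed_le[of k "?r + ?P + 1"] elapsed_nonneg[OF WSETF_admissible, of k ?r] r \<open>?P \<ge> 0\<close>
      by simp
  qed
  ultimately show False by linarith
qed

lemma WSETF_schedule: "schedule I y"
proof -
  have "y j t = 0" if j: "j < njobs I" and t: "0 \<le> t" "t < release I j \<or> completion I y j < t" for j t
  proof (rule ccontr)
    assume "y j t \<noteq> 0"
    from WSETF_rate_nonzero(1)[OF t(1) j this]
    have a: "release I j \<le> t" "elapsed y j t < ptime I j" by (auto simp: active_jobs_def)
    obtain T where "0 \<le> T" "ptime I j \<le> elapsed y j T" using WSETF_completes[OF j] by blast
    from completion_properties(3)[OF WSETF_admissible j ptime_pos[OF j] this t(1)] a t(2)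
    show False by linarith
  qed
  then show ?thesis
    using WSETF_admissible WSETF_completes by (simp add: schedule_def admissible_def)
qed

text \<open>While some active job has ratio below \<theta>, jobs with ratio above \<theta> are not
  processed. So \<open>k\<close> either starts above the truncation level and stands still, or it
  never rises above it; in both cases truncation hides no progress.\<close>

lemma WSETF_truncated_diff:
  assumes k: "k < njobs I" and st: "0 \<le> s" "s \<le> t"
    and below: "\<And>u. s < u \<Longrightarrow> u < t \<Longrightarrow>
      \<exists>j\<in>active_jobs I y u. elapsed y j u < \<theta> * weight I j"
  shows "min (elapsed y k t) (\<theta> * weight I k) - min (elapsed y k s) (\<theta> * weight I k)
    = elapsed y k t - elapsed y k s"
proof -
  note wk = weight_pos[OF k]
  have "elapsed y k t \<le> max (elapsed y k s) (\<theta> * weight I k)"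
  proof (rule elapsed_le_max[OF WSETF_admissible k st])
    fix u assume u: "s < u" "u < t" "\<theta> * weight I k < elapsed y k u"
    from below[OF u(1,2)] obtain j
      where j: "j \<in> active_jobs I y u" "elapsed y j u < \<theta> * weight I j" by blast
    have "elapsed y j u / weight I j < \<theta>"
      using j(2) active_weight_pos[OF j(1)] by (simp add: pos_divide_less_eq)
    also have "\<theta> < elapsed y k u / weight I k"
      using u(3) wk by (simp add: pos_less_divide_eq)
    finally have less: "elapsed y j u / weight I j < elapsed y k u / weight I k" .
    have "0 \<le> u" using u st by simp
    from WSETF_rate_nonzero(2)[OF this k _ j(1)] less show "y k u = 0" by linarith
  qed
  with elapsed_mono[OF WSETF_admissible k st] show ?thesis by (auto simp: min_def max_def split: if_splits)
qed

text \<open>Let \<open>s\<close> be the supremum of the times up to \<open>t\<close> at which all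
  active jobs have ratio at least \<theta>. WSETF is not behind at \<open>s\<close>. From then on it
  is always busy and all its work counts, so it gains \<open>t - s\<close>, which no schedule
  exceeds.\<close>

lemma WSETF_maximizes_truncated:
  assumes x: "schedule I x" and t: "0 \<le> t"
  shows "(\<Sum>k<njobs I. min (elapsed x k t) (\<theta> * weight I k))
    \<le> (\<Sum>k<njobs I. min (elapsed y k t) (\<theta> * weight I k))"
proof -
  define f where "f u = (\<Sum>k<njobs I. min (elapsed y k u) (\<theta> * weight I k))
    - (\<Sum>k<njobs I. min (elapsed x k u) (\<theta> * weight I k))" for u
  define B where "B = {u \<in> {0..t}. \<forall>j\<in>active_jobs I y u. \<theta> * weight I j \<le> elapsed y j u}"
  note adm = WSETF_admissible and xadm = schedule_admissible[OF x]
  have contf: "continuous_on {0..t} f"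
    unfolding f_def
    by (intro continuous_intros elapsed_continuous_on[OF adm] elapsed_continuous_on[OF xadm]) auto
  \<comment> \<open>At such times each job can be compared separately: a job not released before
    \<open>u\<close> has no elapsed time in \<open>x\<close>, an active job has reached the
    truncation level under WSETF, and a finished one cannot be further ahead in
    \<open>x\<close>.\<close>
  have fB: "0 \<le> f u" if "u \<in> B" for u
  proof -
    have "min (elapsed x k u) (\<theta> * weight I k) \<le> min (elapsed y k u) (\<theta> * weight I k)"
      if k: "k < njobs I" for k
    proof -
      have u: "0 \<le> u" using \<open>u \<in> B\<close> by (simp add: B_def)
      consider "u \<le> release I k" | "k \<in> active_jobs I y u" | "ptime I k \<le> elapsed y k u"
        using k by (force simp: active_jobs_def)
      then show ?thesis
      proof cases
        case 1
        then show ?thesis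
          using schedule_properties(3)[OF valid x k u] elapsed_nonneg[OF adm k u] by simp
      next
        case 2
        then show ?thesis using \<open>u \<in> B\<close> by (auto simp: B_def)
      next
        case 3
        then show ?thesis using schedule_properties(2)[OF valid x k u] by simp
      qed
    qed
    then have "(\<Sum>k<njobs I. min (elapsed x k u) (\<theta> * weight I k))
        \<le> (\<Sum>k<njobs I. min (elapsed y k u) (\<theta> * weight I k))"
      by (meson sum_mono lessThan_iff)
    then show ?thesis unfolding f_def by linarith
  qed
  \<comment> \<open>The default 0 covers an empty \<open>B\<close>: both sums agree at time
    0.\<close>
  define s where "s = (if B = {} then 0 else Sup B)"
  have bdd: "bdd_above B" by (auto simp: B_def intro: bdd_aboveI[of _ t])
  have "0 \<le> s \<and> s \<le> t"
  proof (cases "B = {}")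
    case False
    then obtain u where u: "u \<in> B" by blast
    then have "u \<le> Sup B" using bdd by (rule cSup_upper)
    moreover have "Sup B \<le> t" using False by (rule cSup_least) (auto simp: B_def)
    ultimately show ?thesis using u False by (auto simp: s_def B_def)
  qed (use t in \<open>simp add: s_def\<close>)
  then have s: "0 \<le> s" "s \<le> t" by auto
  have "0 \<le> f s"
  proof (cases "B = {}")
    case True
    then show ?thesis by (simp add: s_def f_def)
  next
    case False
    \<comment> \<open>\<open>B\<close> need not be closed, since a job released at its supremum may
      enter below the level. Continuity of \<open>f\<close> carries nonnegativity over to
      \<open>s\<close>.\<close>
    let ?S = "{u \<in> {0..t}. f u \<in> {0..}}"
    have "closed ?S"
      by (intro closed_preimage_atLeastAtMost contf) simp
    moreover have "B \<subseteq> ?S" using fB by (auto simp: B_def)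
    ultimately have "closure B \<subseteq> ?S" by (rule closure_minimal[rotated])
    moreover have "s \<in> closure B"
      using False bdd by (simp add: s_def closure_contains_Sup)
    ultimately show ?thesis by auto
  qed
  have below: "\<exists>j\<in>active_jobs I y u. elapsed y j u < \<theta> * weight I j" if "s < u" "u < t" for u
  proof (rule ccontr)
    assume "\<not> ?thesis"
    then have "u \<in> B" using that s by (auto simp: B_def not_less)
    then show False using that cSup_upper[OF \<open>u \<in> B\<close> bdd] by (auto simp: s_def split: if_splits)
  qed
  have "(\<Sum>k<njobs I. min (elapsed x k t) (\<theta> * weight I k) - min (elapsed x k s) (\<theta> * weight I k))
      \<le> (\<Sum>k<njobs I. elapsed x k t - elapsed x k s)"
    using elapsed_mono[OF xadm _ s] by (intro sum_mono) (force simp: min_def)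
  also have "\<dots> \<le> t - s" by (rule sum_elapsed_diff_le[OF xadm s])
  also have "\<dots> = (\<Sum>k<njobs I. elapsed y k t - elapsed y k s)"
    using WSETF_busy[OF s] below by fastforce
  also have "\<dots> = (\<Sum>k<njobs I. min (elapsed y k t) (\<theta> * weight I k)
      - min (elapsed y k s) (\<theta> * weight I k))"
    using WSETF_truncated_diff[OF _ s below] by simp
  finally show ?thesis using \<open>0 \<le> f s\<close> by (simp add: f_def sum_subtractf)
qed

text \<open>Between its release and its completion, \<open>j\<close> itself is an active job with
  ratio below \<open>ptime I j / weight I j\<close>. Hence the processor is busy throughout, and all
  of its work happens below this ratio level.\<close>

lemma WSETF_completion_le:
  assumes j: "j < njobs I"
  shows "completion I y j \<le> release I j + (\<Sum>k<njobs I.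
      min (ptime I k) (ptime I j / weight I j * weight I k)
      - min (elapsed y k (release I j)) (ptime I j / weight I j * weight I k))"
proof -
  note adm = WSETF_admissible and props = schedule_properties[OF valid WSETF_schedule j]
  let ?r = "release I j" and ?C = "completion I y j" and ?\<theta> = "ptime I j / weight I j"
  note r = release_nonneg[OF j] and wj = weight_pos[OF j]
  have j_active: "j \<in> active_jobs I y u" if u: "?r < u" "u < ?C" for u
  proof -
    obtain T where "0 \<le> T" "ptime I j \<le> elapsed y j T" using WSETF_completes[OF j] by blast
    from completion_properties(3)[OF adm j ptime_pos[OF j] this, of u] show ?thesis
      using u r j by (auto simp: active_jobs_def)
  qed
  have "?C - ?r = (\<Sum>k<njobs I. elapsed y k ?C - elapsed y k ?r)"
    using WSETF_busy[OF r props(1)] j_active by fastforce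
  also have "\<dots> \<le> (\<Sum>k<njobs I. min (ptime I k) (?\<theta> * weight I k)
      - min (elapsed y k ?r) (?\<theta> * weight I k))"
  proof (rule sum_mono)
    fix k assume "k \<in> {..<njobs I}"
    then have k: "k < njobs I" by simp
    have "min (elapsed y k ?C) (?\<theta> * weight I k) - min (elapsed y k ?r) (?\<theta> * weight I k)
      = elapsed y k ?C - elapsed y k ?r"
    proof (rule WSETF_truncated_diff[OF k r props(1)])
      fix u assume "?r < u" "u < ?C"
      from j_active[OF this] show "\<exists>i\<in>active_jobs I y u. elapsed y i u < ?\<theta> * weight I i"
        using wj by (intro bexI[of _ j]) (auto simp: active_jobs_def)
    qed
    with WSETF_elapsed_le[OF k, of ?C] r props(1)
    show "elapsed y k ?C - elapsed y k ?r \<le> min (ptime I k) (?\<theta> * weight I k)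
      - min (elapsed y k ?r) (?\<theta> * weight I k)" by linarith
  qed
  finally show ?thesis by linarith
qed

end

section \<open>Competitiveness\<close>

text \<open>The processor does at most one unit of work per unit of time. The term for
  \<open>k = j\<close> is the processing of \<open>j\<close> itself.\<close>

lemma schedule_completion_ge:
  assumes "valid_instance I" "schedule I x" "j < njobs I"
  shows "release I j + (\<Sum>k<njobs I. elapsed x k (completion I x j) - elapsed x k (release I j))
    \<le> completion I x j"
  using sum_elapsed_diff_le[OF schedule_admissible[OF assms(2)] _ schedule_properties(1)[OF assms]] assms
  by (force simp: valid_instance_def)

text \<open>If \<open>a - u\<close> is the smaller reduced value, the difference is at most
  \<open>u\<close> because \<open>min a b \<le> a\<close>, and at most \<open>b\<close> because
  \<open>a - u\<close> is nonnegative. The other case is symmetric.\<close>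

lemma min_diff_le:
  fixes a b u v :: real
  assumes "0 \<le> u" "u \<le> a" "0 \<le> v" "v \<le> b"
  shows "min a b - min (a - u) (b - v) \<le> min u b + min v a"
  using assms by (auto simp: min_def)

text \<open>Whichever job finishes first has by then delayed the other one by all the work that it had
  left when the other one was released.\<close>

lemma schedule_pair_delay:
  assumes valid: "valid_instance I" and x: "schedule I x" and j: "j < njobs I" and k: "k < njobs I"
  shows "min (weight I j * ptime I k) (weight I k * ptime I j)
      - min (weight I j * elapsed x k (release I j)) (weight I k * ptime I j)
      - min (weight I k * elapsed x j (release I k)) (weight I j * ptime I k)
    \<le> weight I j * (elapsed x k (completion I x j) - elapsed x k (release I j))
      + weight I k * (elapsed x j (completion I x k) - elapsed x j (release I k))"
proof -
  note adm = schedule_admissible[OF x]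
  have w: "0 < weight I j" "0 < weight I k" and r: "0 \<le> release I j" "0 \<le> release I k"
    using valid j k by (auto simp: valid_instance_def)
  note pj = schedule_properties[OF valid x j] and pk = schedule_properties[OF valid x k]
  let ?d = "\<lambda>j k. weight I j * (elapsed x k (completion I x j) - elapsed x k (release I j))"
  have nonneg: "0 \<le> ?d j k" "0 \<le> ?d k j"
    using elapsed_mono[OF adm k r(1) pj(1)] elapsed_mono[OF adm j r(2) pk(1)] w by auto
  have "min (weight I j * ptime I k - weight I j * elapsed x k (release I j))
      (weight I k * ptime I j - weight I k * elapsed x j (release I k)) \<le> ?d j k + ?d k j"
  \<comment> \<open>The delay caused by the job that finishes first equals one of the arguments of
    \<open>min\<close>; the other delay is nonnegative.\<close>
  proof (cases "completion I x k \<le> completion I x j")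
    case True
    then show ?thesis using pk(4) nonneg by (simp add: right_diff_distrib min_le_iff_disj)
  next
    case False
    then show ?thesis using pj(4) nonneg by (simp add: right_diff_distrib min_le_iff_disj)
  qed
  \<comment> \<open>Replacing remaining work by full processing times costs the work done before the
    releases. Truncating this cost yields terms of the kind that WSETF maximizes.\<close>
  moreover have "min (weight I j * ptime I k) (weight I k * ptime I j)
      - min (weight I j * ptime I k - weight I j * elapsed x k (release I j))
          (weight I k * ptime I j - weight I k * elapsed x j (release I k))
    \<le> min (weight I j * elapsed x k (release I j)) (weight I k * ptime I j)
      + min (weight I k * elapsed x j (release I k)) (weight I j * ptime I k)"
    by (rule min_diff_le)
      (use w pk(2)[OF r(1)] pj(2)[OF r(2)] elapsed_nonneg[OF adm k r(1)] elapsed_nonneg[OF adm j r(2)]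
       in auto)
  ultimately show ?thesis by linarith
qed

text \<open>With \<open>R\<close> for the sum of \<open>w j * r j\<close> and the letters below for
  their double sums, twice the cost of \<open>x\<close> is at least \<open>2R + 2D\<close>, hence at
  least \<open>2R + M - 2X\<close>, hence at least \<open>R + M - Y\<close>, which bounds the cost
  of \<open>y\<close>.\<close>

lemma WSETF_cost_le:
  assumes valid: "valid_instance I" and W: "WSETF I y" and x: "schedule I x"
  shows "cost I y \<le> 2 * cost I x"
proof -
  let ?n = "njobs I"
  define r where "r = release I"
  define w where "w = weight I"
  define M where "M j k = min (w j * ptime I k) (w k * ptime I j)" for j k
  define X where "X j k = min (w j * elapsed x k (r j)) (w k * ptime I j)" for j k
  define Y where "Y j k = min (w j * elapsed y k (r j)) (w k * ptime I j)" for j k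
  define D where "D j k = w j * (elapsed x k (completion I x j) - elapsed x k (r j))" for j k
  have w: "0 < w j" and r: "0 \<le> r j" if "j < ?n" for j
    using valid that by (auto simp: valid_instance_def w_def r_def)
  \<comment> \<open>Multiplying by \<open>w j\<close> turns truncation at ratio
    \<open>ptime I j / w j\<close> into the form of \<open>M\<close>, \<open>X\<close> and
    \<open>Y\<close>; \<open>M\<close> becomes symmetric in \<open>j\<close> and
    \<open>k\<close>.\<close>
  have scale: "w j * min a (ptime I j * w k / w j) = min (w j * a) (w k * ptime I j)"
    if "j < ?n" for j k a
    using w[OF that] by (simp add: min_mult_distrib_left mult.commute)
  have "cost I y \<le> (\<Sum>j<?n. w j * r j + (\<Sum>k<?n. M j k - Y j k))"
    unfolding cost_def
  proof (rule sum_mono)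
    fix j assume "j \<in> {..<?n}"
    then have j: "j < ?n" by simp
    from mult_left_mono[OF WSETF_completion_le[OF valid W j], of "w j"] w[OF j]
    show "weight I j * completion I y j \<le> w j * r j + (\<Sum>k<?n. M j k - Y j k)"
      by (simp add: distrib_left right_diff_distrib sum_distrib_left scale[OF j] M_def Y_def
          flip: w_def r_def)
  qed
  moreover have "(\<Sum>j<?n. w j * r j + (\<Sum>k<?n. D j k)) \<le> cost I x"
    unfolding cost_def
  proof (rule sum_mono)
    fix j assume "j \<in> {..<?n}"
    then have j: "j < ?n" by simp
    from mult_left_mono[OF schedule_completion_ge[OF valid x j], of "w j"] w[OF j]
    show "w j * r j + (\<Sum>k<?n. D j k) \<le> weight I j * completion I x j"
      by (simp add: distrib_left sum_distrib_left D_def flip: w_def r_def)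
  qed
  \<comment> \<open>The pairwise bound is summed over all ordered pairs, including
    \<open>j = k\<close>. Exchanging the order of summation identifies the two copies of
    \<open>D\<close> and of \<open>X\<close>.\<close>
  moreover have "(\<Sum>j<?n. \<Sum>k<?n. M j k) - 2 * (\<Sum>j<?n. \<Sum>k<?n. X j k) \<le> 2 * (\<Sum>j<?n. \<Sum>k<?n. D j k)"
  proof -
    have "(\<Sum>j<?n. \<Sum>k<?n. M j k - X j k - X k j) \<le> (\<Sum>j<?n. \<Sum>k<?n. D j k + D k j)"
      using schedule_pair_delay[OF valid x]
      by (intro sum_mono) (simp add: M_def X_def D_def w_def r_def)
    moreover have "(\<Sum>j<?n. \<Sum>k<?n. D k j) = (\<Sum>j<?n. \<Sum>k<?n. D j k)"
      "(\<Sum>j<?n. \<Sum>k<?n. X k j) = (\<Sum>j<?n. \<Sum>k<?n. X j k)"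
      by (rule sum.swap)+
    ultimately show ?thesis by (simp add: sum.distrib sum_subtractf)
  qed
  \<comment> \<open>One copy of \<open>X\<close> is paid for by the release dates, since at most
    \<open>r j\<close> work is done before \<open>r j\<close>. The other is paid for by the
    maximality of WSETF at time \<open>r j\<close> and ratio \<open>ptime I j / w j\<close>.\<close>
  moreover have "2 * (\<Sum>j<?n. \<Sum>k<?n. X j k)
      \<le> (\<Sum>j<?n. w j * r j) + (\<Sum>j<?n. \<Sum>k<?n. Y j k)"
  proof -
    have "(\<Sum>j<?n. \<Sum>k<?n. X j k) \<le> (\<Sum>j<?n. w j * r j)"
    proof (rule sum_mono)
      fix j assume "j \<in> {..<?n}"
      then have j: "j < ?n" by simp
      have "(\<Sum>k<?n. X j k) \<le> w j * (\<Sum>k<?n. elapsed x k (r j) - elapsed x k 0)"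
        by (simp add: sum_distrib_left sum_mono X_def)
      also have "\<dots> \<le> w j * r j"
        using sum_elapsed_diff_le[OF schedule_admissible[OF x] order_refl r[OF j]] w[OF j] by simp
      finally show "(\<Sum>k<?n. X j k) \<le> w j * r j" .
    qed
    moreover have "(\<Sum>j<?n. \<Sum>k<?n. X j k) \<le> (\<Sum>j<?n. \<Sum>k<?n. Y j k)"
    proof (rule sum_mono)
      fix j assume "j \<in> {..<?n}"
      then have j: "j < ?n" by simp
      from mult_left_mono[OF WSETF_maximizes_truncated[OF valid W x r[OF j], of "ptime I j / w j"], of "w j"]
        w[OF j]
      show "(\<Sum>k<?n. X j k) \<le> (\<Sum>k<?n. Y j k)"
        by (simp add: sum_distrib_left scale[OF j] X_def Y_def flip: w_def)
    qed
    ultimately show ?thesis by linarith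
  qed
  ultimately show ?thesis by (simp add: sum.distrib sum_subtractf)
qed

lemma WSETF_2_competitive:
  assumes "valid_instance I" "WSETF I y"
  shows "cost I y \<le> 2 * OPT I"
proof -
  \<comment> \<open>The run \<open>y\<close> is itself a schedule, so the infimum is over a nonempty
    set.\<close>
  have "cost I y / 2 \<le> Inf {cost I x |x. schedule I x}"
    by (rule cInf_greatest) (use WSETF_schedule[OF assms] WSETF_cost_le[OF assms] in \<open>auto simp: mult.commute\<close>)
  then show ?thesis by (simp add: OPT_def)
qed

section \<open>Existence of a run\<close>

text \<open>Counterpart of \<open>active_jobs\<close> for an explicit vector of elapsed times, so
  that a run can be started from an intermediate state.\<close>

definition available :: "sched_instance \<Rightarrow> real \<Rightarrow> (nat \<Rightarrow> real) \<Rightarrow> nat set" where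
  "available I t Z = {k. k < njobs I \<and> release I k \<le> t \<and> Z k < ptime I k}"

text \<open>A run that starts at \<open>t\<^sub>0\<close> with work \<open>Z\<close> already done.
  Measurability and boundedness on the whole line make such runs easy to concatenate.\<close>

definition WSETF_from :: "sched_instance \<Rightarrow> real \<Rightarrow> (nat \<Rightarrow> real) \<Rightarrow> rates \<Rightarrow> bool" where
  "WSETF_from I t\<^sub>0 Z y \<longleftrightarrow>
    (\<forall>j. y j \<in> borel_measurable borel \<and> (\<forall>t. \<bar>y j t\<bar> \<le> 1)) \<and>
    (\<forall>t\<ge>t\<^sub>0. \<forall>j. y j t = WSETF_rate (weight I)
      (available I t (\<lambda>k. Z k + integral {t\<^sub>0..t} (y k))) (\<lambda>k. Z k + integral {t\<^sub>0..t} (y k)) j)"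

text \<open>Each release decreases the first summand and each completion the second one. In between, the
  jobs of minimum ratio only change when another job joins them, which decreases the second
  component.\<close>

definition events_left :: "sched_instance \<Rightarrow> real \<Rightarrow> (nat \<Rightarrow> real) \<Rightarrow> nat \<times> nat" where
  "events_left I t Z =
    (card {k. k < njobs I \<and> t < release I k} + card {k. k < njobs I \<and> Z k < ptime I k},
     card (available I t Z - min_ratio_jobs (weight I) (available I t Z) Z))"

text \<open>The current rates are kept until the first event: a release, a completion, or a waiting
  job being caught up by the processed ones. Until then the decision of the rule stays the same. The
  assumption \<open>work\<close> ensures that there is a next event.\<close>

lemma WSETF_step:
  assumes valid: "valid_instance I"
    and work: "available I t\<^sub>0 Z \<noteq> {} \<or> (\<exists>k<njobs I. t\<^sub>0 < release I k)"
    and \<rho>_def: "\<rho> = WSETF_rate (weight I) (available I t\<^sub>0 Z) Z"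
    and Z'_def: "Z' = (\<lambda>t k. Z k + (t - t\<^sub>0) * \<rho> k)"
  obtains t\<^sub>1 where "t\<^sub>0 < t\<^sub>1"
    "\<And>t. t\<^sub>0 \<le> t \<Longrightarrow> t < t\<^sub>1 \<Longrightarrow> WSETF_rate (weight I) (available I t (Z' t)) (Z' t) = \<rho>"
    "(events_left I t\<^sub>1 (Z' t\<^sub>1), events_left I t\<^sub>0 Z) \<in> less_than <*lex*> less_than"
proof -
  define w where "w = weight I"
  define J where "J = available I t\<^sub>0 Z"
  define A where "A = min_ratio_jobs w J Z"
  define W where "W = (\<Sum>k\<in>A. w k)"
  define U where "U = {k. k < njobs I \<and> t\<^sub>0 < release I k}"
  define \<mu> where "\<mu> = Min ((\<lambda>k. Z k / w k) ` J)"
  \<comment> \<open>At constant rates, the common ratio of the jobs in \<open>A\<close> rises from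
    \<mu> at speed \<open>1 / W\<close>, so it meets the ratio of a waiting job \<open>k\<close>
    after time \<open>W * (Z k / w k - \<mu>)\<close>.\<close>
  define D where "D = release I ` U \<union> (\<lambda>k. t\<^sub>0 + (ptime I k - Z k) / \<rho> k) ` A
    \<union> (\<lambda>k. t\<^sub>0 + W * (Z k / w k - \<mu>)) ` (J - A)"
  define t\<^sub>1 where "t\<^sub>1 = Min D"
  have AJ: "A \<subseteq> J" by (auto simp: A_def min_ratio_jobs_def)
  have J: "k < njobs I" "release I k \<le> t\<^sub>0" "Z k < ptime I k" "0 < w k" if "k \<in> J" for k
    using that valid by (auto simp: J_def available_def w_def valid_instance_def)
  have finJ: "finite J" using J(1) by (meson finite_lessThan finite_subset lessThan_iff subsetI)
  then have finA: "finite A" using AJ finite_subset by blast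
  have A_ne: "A \<noteq> {}" if "J \<noteq> {}" unfolding A_def using min_ratio_jobs_nonempty[OF finJ that] .
  have W: "0 < W" if "k \<in> J" for k
    unfolding W_def using finA A_ne that AJ J(4) by (intro sum_pos) auto
  have ratio: "\<mu> \<le> Z k / w k" "k \<in> A \<longleftrightarrow> Z k / w k = \<mu>" if "k \<in> J" for k
  proof -
    show le: "\<mu> \<le> Z k / w k" unfolding \<mu>_def using finJ that by auto
    have "\<mu> \<in> (\<lambda>k. Z k / w k) ` J" unfolding \<mu>_def using finJ that by (intro Min_in) auto
    then obtain i where "i \<in> J" "\<mu> = Z i / w i" by auto
    moreover have "\<mu> \<le> Z i / w i" if "i \<in> J" for i unfolding \<mu>_def using finJ that by auto
    ultimately show "k \<in> A \<longleftrightarrow> Z k / w k = \<mu>"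
      using that le by (force simp: A_def min_ratio_jobs_def)
  qed
  have \<rho>: "\<rho> k = (if k \<in> A then w k / W else 0)" for k
    by (simp add: \<rho>_def WSETF_rate_def A_def W_def J_def w_def)
  have \<rho>_pos: "0 < \<rho> k" if "k \<in> A" for k
  proof -
    have "k \<in> J" using that AJ by blast
    then show ?thesis using \<rho> that W[of k] J(4) by simp
  qed
  have \<rho>_nonneg: "0 \<le> \<rho> k" for k using \<rho>[of k] \<rho>_pos[of k] by (cases "k \<in> A") auto
  have finD: "finite D" using finA finJ by (simp add: D_def U_def)
  have "D \<noteq> {}" using work A_ne by (auto simp: D_def U_def J_def)
  then have t1_D: "t\<^sub>1 \<in> D" unfolding t\<^sub>1_def using finD by (rule Min_in[rotated])
  have t1_le: "t\<^sub>1 \<le> d" if "d \<in> D" for d unfolding t\<^sub>1_def using finD that by (rule Min_le)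
  have "t\<^sub>0 < d" if d: "d \<in> D" for d
  proof -
    consider k where "k \<in> U" "d = release I k" | k where "k \<in> A" "d = t\<^sub>0 + (ptime I k - Z k) / \<rho> k"
      | k where "k \<in> J - A" "d = t\<^sub>0 + W * (Z k / w k - \<mu>)"
      using d unfolding D_def by blast
    then show ?thesis
    proof cases
      case 2
      then show ?thesis using \<rho>_pos AJ J(3) by force
    next
      case 3
      then have "\<mu> < Z k / w k" using ratio[of k] by auto
      then show ?thesis using 3 W[of k] by simp
    qed (simp add: U_def)
  qed
  then have less: "t\<^sub>0 < t\<^sub>1" using t1_D by blast
  have Z'_A: "Z' t k / w k = \<mu> + (t - t\<^sub>0) / W" if "k \<in> A" for t k
  proof -
    have "k \<in> J" using that AJ by blast
    then have "Z k / w k = \<mu>" "0 < w k" using ratio(2) that J(4) by auto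
    then show ?thesis using that by (simp add: Z'_def \<rho> add_divide_distrib)
  qed
  have Z'_not_A: "Z' t k = Z k" if "k \<notin> A" for t k
    using that by (simp add: Z'_def \<rho>)
  have Z'_ge: "Z k \<le> Z' t k" if "t\<^sub>0 \<le> t" for t k
    using that \<rho>_nonneg[of k] by (simp add: Z'_def)
  have level: "\<mu> + (t - t\<^sub>0) / W \<le> Z k / w k" "t < t\<^sub>1 \<Longrightarrow> \<mu> + (t - t\<^sub>0) / W < Z k / w k"
    if "t \<le> t\<^sub>1" "k \<in> J - A" for t k
  proof -
    have "t\<^sub>1 \<le> t\<^sub>0 + W * (Z k / w k - \<mu>)" using that by (intro t1_le) (auto simp: D_def)
    moreover have "0 < W" using W[of k] that by blast
    ultimately have "(t\<^sub>1 - t\<^sub>0) / W \<le> Z k / w k - \<mu>" by (simp add: pos_divide_le_eq mult.commute)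
    moreover have "(t - t\<^sub>0) / W \<le> (t\<^sub>1 - t\<^sub>0) / W" "t < t\<^sub>1 \<Longrightarrow> (t - t\<^sub>0) / W < (t\<^sub>1 - t\<^sub>0) / W"
      using \<open>0 < W\<close> that by (auto simp: divide_right_mono divide_strict_right_mono)
    ultimately show "\<mu> + (t - t\<^sub>0) / W \<le> Z k / w k" "t < t\<^sub>1 \<Longrightarrow> \<mu> + (t - t\<^sub>0) / W < Z k / w k"
      by linarith+
  qed
  have Z'_ratio: "\<mu> + (t - t\<^sub>0) / W \<le> Z' t k / w k" if "t \<le> t\<^sub>1" "k \<in> J" for t k
    using that Z'_A[of k t] Z'_not_A[of k t] level(1)[of t k] by (cases "k \<in> A") auto
  have "WSETF_rate w (available I t (Z' t)) (Z' t) = \<rho>" if t: "t\<^sub>0 \<le> t" "t < t\<^sub>1" for t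
  proof -
    have "k \<in> available I t (Z' t)" if k: "k \<in> J" for k
    proof -
      have "Z' t k < ptime I k"
      proof (cases "k \<in> A")
        case True
        then have "t\<^sub>1 \<le> t\<^sub>0 + (ptime I k - Z k) / \<rho> k" by (intro t1_le) (auto simp: D_def)
        then have "t - t\<^sub>0 < (ptime I k - Z k) / \<rho> k" using t by linarith
        then show ?thesis using \<rho>_pos[OF True] by (simp add: pos_less_divide_eq Z'_def)
      qed (use Z'_not_A J(3) k in auto)
      then show ?thesis using J(1,2)[OF k] t by (auto simp: available_def)
    qed
    moreover have "k \<in> J" if "k \<in> available I t (Z' t)" for k
    proof -
      have k: "k < njobs I" "release I k \<le> t" "Z k < ptime I k"
        using that Z'_ge[OF t(1), of k] by (auto simp: available_def)
      have "\<not> t\<^sub>0 < release I k"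
      proof
        assume "t\<^sub>0 < release I k"
        then have "t\<^sub>1 \<le> release I k" using k by (intro t1_le) (auto simp: D_def U_def)
        then show False using k t by linarith
      qed
      then show ?thesis using k by (simp add: J_def available_def)
    qed
    ultimately have J': "available I t (Z' t) = J" by blast
    \<comment> \<open>Strictly before \<open>t\<^sub>1\<close> the rising common ratio of
      \<open>A\<close> is still below the ratios of all other jobs in \<open>J\<close>.\<close>
    have "min_ratio_jobs w J (Z' t) = A"
    proof (intro equalityI subsetI)
      fix k assume "k \<in> min_ratio_jobs w J (Z' t)"
      then have k: "k \<in> J" "\<And>i. i \<in> J \<Longrightarrow> Z' t k / w k \<le> Z' t i / w i"
        by (auto simp: min_ratio_jobs_def)
      obtain i where i: "i \<in> A" using A_ne k(1) by blast
      show "k \<in> A"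
      proof (rule ccontr)
        assume nA: "k \<notin> A"
        have "Z' t i / w i < Z' t k / w k"
          using level(2)[of t k] t k(1) nA Z'_A[OF i] Z'_not_A[OF nA] by simp
        moreover have "Z' t k / w k \<le> Z' t i / w i" using k(2) i AJ by blast
        ultimately show False by linarith
      qed
    next
      fix k assume "k \<in> A"
      then show "k \<in> min_ratio_jobs w J (Z' t)"
        using AJ Z'_A Z'_ratio[of t] t by (auto simp: min_ratio_jobs_def)
    qed
    then show ?thesis
      unfolding J' by (auto simp: WSETF_rate_def \<rho> W_def)
  qed
  moreover have "(events_left I t\<^sub>1 (Z' t\<^sub>1), events_left I t\<^sub>0 Z) \<in> less_than <*lex*> less_than"
  proof -
    define U' where "U' = {k. k < njobs I \<and> t\<^sub>1 < release I k}"
    define F where "F = {k. k < njobs I \<and> Z k < ptime I k}"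
    define F' where "F' = {k. k < njobs I \<and> Z' t\<^sub>1 k < ptime I k}"
    have fin: "finite U" "finite F" by (auto simp: U_def F_def)
    have sub: "U' \<subseteq> U" "F' \<subseteq> F"
      using less Z'_ge[of t\<^sub>1] by (auto simp: U_def U'_def F_def F'_def intro: le_less_trans less_trans)
    note le = card_mono[OF fin(1) sub(1)] card_mono[OF fin(2) sub(2)]
    show ?thesis
    \<comment> \<open>Both sets can only shrink, so any change lowers the first component of the
      measure. Otherwise the event is neither a release nor a completion, and some job outside
      \<open>A\<close> attains the minimum ratio.\<close>
    proof (cases "U' = U \<and> F' = F")
      case False
      then have "card U' < card U \<or> card F' < card F"
        using sub fin psubset_card_mono by blast
      then have "card U' + card F' < card U + card F" using le by linarith
      then show ?thesis by (simp add: events_left_def U_def U'_def F_def F'_def)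
    next
      case True
      have "available I t\<^sub>1 (Z' t\<^sub>1) = F' - U'"
        by (auto simp: available_def U'_def F'_def not_less)
      also have "\<dots> = J"
        using True by (auto simp: J_def available_def U_def F_def not_less)
      finally have J': "available I t\<^sub>1 (Z' t\<^sub>1) = J" .
      define A' where "A' = min_ratio_jobs w J (Z' t\<^sub>1)"
      have A': "k \<in> A'" if "k \<in> J" "Z' t\<^sub>1 k / w k = \<mu> + (t\<^sub>1 - t\<^sub>0) / W" for k
        using that Z'_ratio[OF order_refl] by (auto simp: A'_def min_ratio_jobs_def)
      then have "A \<subseteq> A'" using AJ Z'_A by blast
      consider k where "k \<in> U" "t\<^sub>1 = release I k"
        | k where "k \<in> A" "t\<^sub>1 = t\<^sub>0 + (ptime I k - Z k) / \<rho> k"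
        | k where "k \<in> J - A" "t\<^sub>1 = t\<^sub>0 + W * (Z k / w k - \<mu>)"
        using t1_D unfolding D_def by blast
      then obtain k where k: "k \<in> J - A" "t\<^sub>1 = t\<^sub>0 + W * (Z k / w k - \<mu>)"
      proof cases
        case 1
        then have "k \<notin> U'" by (simp add: U'_def)
        then show ?thesis using 1 True by simp
      next
        case 2
        then have "Z' t\<^sub>1 k = ptime I k" using \<rho>_pos[of k] by (simp add: Z'_def)
        then have "k \<notin> F'" "k \<in> F" using AJ J 2 by (auto simp: F_def F'_def)
        then show ?thesis using True by simp
      qed
      moreover have "0 < W" using W[of k] k by blast
      ultimately have "k \<in> A'" using A'[of k] Z'_not_A[of k] by simp
      then have "J - A' \<subset> J - A" using k \<open>A \<subseteq> A'\<close> by blast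
      then have "card (J - A') < card (J - A)" using finJ by (intro psubset_card_mono) auto
      then show ?thesis
        using True J'
        by (simp add: events_left_def U_def U'_def F_def F'_def A_def A'_def w_def flip: J_def)
    qed
  qed
  ultimately show thesis using less that by (simp add: w_def)
qed

text \<open>Well-founded induction on \<open>events_left\<close>: constant rates up to the next
  event are followed by a run from the state reached there. Once no job is available or still to be
  released, zero rates are a run.\<close>

lemma WSETF_from_exists:
  assumes valid: "valid_instance I"
  shows "0 \<le> t\<^sub>0 \<Longrightarrow> \<exists>y. WSETF_from I t\<^sub>0 Z y"
proof (induction "events_left I t\<^sub>0 Z" arbitrary: t\<^sub>0 Z rule: wf_induct_rule[OF wf_lex_prod[OF wf_less_than wf_less_than]])
  case (1 t\<^sub>0 Z)
  show ?case
  proof (cases "available I t\<^sub>0 Z \<noteq> {} \<or> (\<exists>k<njobs I. t\<^sub>0 < release I k)")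
    case False
    then have "available I t Z = {}" if "t\<^sub>0 \<le> t" for t
      by (fastforce simp: available_def)
    then have "WSETF_from I t\<^sub>0 Z (\<lambda>_ _. 0)" by (simp add: WSETF_from_def)
    then show ?thesis by blast
  next
    case True
    define \<rho> where "\<rho> = WSETF_rate (weight I) (available I t\<^sub>0 Z) Z"
    define Z' where "Z' = (\<lambda>t k. Z k + (t - t\<^sub>0) * \<rho> k)"
    obtain t\<^sub>1 where t1: "t\<^sub>0 < t\<^sub>1"
      and rate: "\<And>t. t\<^sub>0 \<le> t \<Longrightarrow> t < t\<^sub>1 \<Longrightarrow>
        WSETF_rate (weight I) (available I t (Z' t)) (Z' t) = \<rho>"
      and dec: "(events_left I t\<^sub>1 (Z' t\<^sub>1), events_left I t\<^sub>0 Z) \<in> less_than <*lex*> less_than"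
      using WSETF_step[OF valid True \<rho>_def Z'_def] by blast
    have "0 \<le> t\<^sub>1" using t1 \<open>0 \<le> t\<^sub>0\<close> by simp
    obtain z where z: "WSETF_from I t\<^sub>1 (Z' t\<^sub>1) z" using 1(1)[OF dec \<open>0 \<le> t\<^sub>1\<close>] by blast
    define y where "y j t = (if t < t\<^sub>1 then \<rho> j else z j t)" for j t
    have zm [measurable]: "z j \<in> borel_measurable borel" and z1: "\<bar>z j t\<bar> \<le> 1" for j t
      using z by (auto simp: WSETF_from_def)
    have pos: "0 < weight I k" if "k \<in> available I t\<^sub>0 Z" for k
      using that valid by (auto simp: available_def valid_instance_def)
    have \<rho>1: "\<bar>\<rho> j\<bar> \<le> 1" for j
    proof (cases "j < njobs I")
      case True
      have "available I t\<^sub>0 Z \<subseteq> {..<njobs I}" by (auto simp: available_def)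
      then show ?thesis
        using WSETF_rate_nonneg[OF pos] WSETF_rate_le_1[OF _ pos True]
        by (simp add: \<rho>_def)
    qed (simp add: \<rho>_def WSETF_rate_def min_ratio_jobs_def available_def)
    have ym: "y j \<in> borel_measurable borel" for j
      unfolding y_def by measurable
    have y1: "\<bar>y j t\<bar> \<le> 1" for j t using z1 \<rho>1 by (simp add: y_def)
    have int: "y j integrable_on {a..b}" if "0 \<le> a" for a b j
    proof (rule bounded_measurable_integrable_on[OF _ y1 that])
      show "y j \<in> borel_measurable (lebesgue_on {0..})"
        using ym by (intro measurable_restrict_space1 measurable_completion) simp
    qed
    \<comment> \<open>At \<open>t\<^sub>1\<close> itself \<open>y\<close> already follows
      \<open>z\<close>; this single point does not affect the integral.\<close>
    have before: "Z k + integral {t\<^sub>0..t} (y k) = Z' t k" if "t\<^sub>0 \<le> t" "t \<le> t\<^sub>1" for t k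
    proof -
      have "integral {t\<^sub>0..t} (y k) = integral {t\<^sub>0..t} (\<lambda>_. \<rho> k)"
        by (rule integral_spike[where S="{t\<^sub>1}"]) (use that in \<open>auto simp: y_def\<close>)
      then show ?thesis using that by (simp add: Z'_def)
    qed
    have after: "Z k + integral {t\<^sub>0..t} (y k) = Z' t\<^sub>1 k + integral {t\<^sub>1..t} (z k)" if "t\<^sub>1 \<le> t" for t k
    proof -
      have "integral {t\<^sub>0..t\<^sub>1} (y k) + integral {t\<^sub>1..t} (y k) = integral {t\<^sub>0..t} (y k)"
        using that t1 int[OF \<open>0 \<le> t\<^sub>0\<close>] by (intro Henstock_Kurzweil_Integration.integral_combine) auto
      moreover have "integral {t\<^sub>1..t} (y k) = integral {t\<^sub>1..t} (z k)"
        by (rule integral_cong) (simp add: y_def)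
      ultimately show ?thesis using before[of t\<^sub>1 k] t1 by simp
    qed
    have "WSETF_from I t\<^sub>0 Z y"
      unfolding WSETF_from_def
    proof (intro conjI allI impI ym y1)
      fix t j assume t: "t\<^sub>0 \<le> t"
      show "y j t = WSETF_rate (weight I) (available I t (\<lambda>k. Z k + integral {t\<^sub>0..t} (y k)))
        (\<lambda>k. Z k + integral {t\<^sub>0..t} (y k)) j"
      proof (cases "t < t\<^sub>1")
        case True
        then show ?thesis using rate[OF t True] t by (simp add: before y_def)
      next
        case False
        then show ?thesis using z by (simp add: after y_def WSETF_from_def)
      qed
    qed
    then show ?thesis by blast
  qed
qed

lemma WSETF_exists:
  assumes "valid_instance I"
  shows "\<exists>y. WSETF I y"
proof -
  obtain y where y: "WSETF_from I 0 (\<lambda>_. 0) y" using WSETF_from_exists[OF assms order_refl] by blast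
  then have "y j \<in> borel_measurable (lebesgue_on {0..})" for j
    by (intro measurable_restrict_space1 measurable_completion) (simp add: WSETF_from_def)
  moreover have "active_jobs I y t = available I t (\<lambda>k. integral {0..t} (y k))" for t
    by (simp add: active_jobs_def available_def elapsed_def)
  ultimately have "WSETF I y"
    using y by (simp add: WSETF_def WSETF_from_def measurable_rates_def elapsed_def)
  then show ?thesis by blast
qed

text \<open>The existence claim keeps the bound from being vacuous; the bound itself covers every
  run.\<close>

theorem theorem1p6:
  fixes I :: sched_instance
  assumes "valid_instance I"
  shows "(\<exists>y. WSETF I y) \<and>
         (\<forall>y. WSETF I y \<longrightarrow> schedule I y \<and> cost I y \<le> 2 * OPT I)"
  using WSETF_exists WSETF_schedule WSETF_2_competitive assms by blast

end
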